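(* Let $d\ge1$ and let $\{\mathbf{X}_n\}_{n\ge1}$ be an exchangeable sequence of $\mathcal{S}_d$-valued random matrices with mean $\mathbf{M}=\mathbb{E}\,\mathbf{X}_1$ and variance upper bound $\mathbb{E}(\mathbf{X}_1-\mathbf{M})^2\preceq\mathbf{V}$. Let $\overline{\mathbf{X}}_n=\frac1n(\mathbf{X}_1+\dots+\mathbf{X}_n)$. Then for any deterministic $\mathbf{A}\in\mathcal{S}_d^{++}$, $$\mathbb{P}\big(\exists n\ge 1,\ \mathrm{abs}(\overline{\mathbf{X}}_n-\mathbf{M})\not\preceq\mathbf{A}\big)\le\mathrm{tr}(\mathbf{V}\mathbf{A}^{-2}).$$ Further, if $\mathbb{E}\{\mathbf{X}_i-\mathbf{M},\mathbf{X}_j-\mathbf{M}\}=0$ for all $i\ne j$, then for any fixed integer $N\ge1$, $$\mathbb{P}\big(\exists n\ge N,\ \mathrm{abs}(\overline{\mathbf{X}}_n-\mathbf{M})\not\preceq\mathbf{A}\big)\le N^{-1}\,\mathrm{tr}(\mathbf{V}\mathbf{A}^{-2}).$$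
   Context: $\mathcal{S}_d$ is the set of real symmetric $d\times d$ matrices, $\mathcal{S}_d^{++}$ the subset of positive definite ones. $\preceq$ is the Loewner order: $\mathbf{A}\preceq\mathbf{B}$ iff $\mathbf{B}-\mathbf{A}$ is positive semidefinite; $\mathbf{A}\not\preceq\mathbf{B}$ is its negation. $\mathrm{abs}(\mathbf{X})$ is the matrix absolute value, obtained by applying $x\mapsto|x|$ to the eigenvalues in an orthogonal diagonalization of $\mathbf{X}$. $\{\mathbf{A},\mathbf{B}\}=\mathbf{A}\mathbf{B}+\mathbf{B}\mathbf{A}$ is the anticommutator. Expectations are entrywise. A sequence $X_1,X_2,\dots$ is exchangeable if $(X_{i_1},\dots,X_{i_k})$ and $(X_{j_1},\dots,X_{j_k})$ have the same joint distribution for all $k$, all distinct $i_1,\dots,i_k$ and all distinct $j_1,\dots,j_k$. *)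

theory Defs
  imports "HOL-Probability.Probability"
begin

definition sym_mats :: "(real^'n^'n) set"
  where "sym_mats = {A. transpose A = A}"

definition psd_mats :: "(real^'n^'n) set"
  where "psd_mats = {A \<in> sym_mats. \<forall>x. 0 \<le> x \<bullet> (A *v x)}"

definition pd_mats :: "(real^'n^'n) set"
  where "pd_mats = {A \<in> sym_mats. \<forall>x. x \<noteq> 0 \<longrightarrow> 0 < x \<bullet> (A *v x)}"

definition loewner_le :: "real^'n^'n \<Rightarrow> real^'n^'n \<Rightarrow> bool"  (infix \<open>\<preceq>\<close> 50)
  where "A \<preceq> B \<longleftrightarrow> B - A \<in> psd_mats"

definition diagonal :: "('n \<Rightarrow> real) \<Rightarrow> real^'n^'n"
  where "diagonal c = (\<chi> i j. if i = j then c i else 0)"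

text \<open>The value of \<open>mat_abs X\<close> is meaningful for symmetric \<open>X\<close> only, where an orthogonal
  diagonalization exists; it does not depend on the chosen diagonalization, see
  \<open>mat_abs_unique\<close> and \<open>mat_abs_eq\<close>.\<close>

definition is_mat_abs :: "real^'n^'n \<Rightarrow> real^'n^'n \<Rightarrow> bool"
  where "is_mat_abs X Y \<longleftrightarrow> (\<exists>Q c. orthogonal_matrix Q \<and>
           X = Q ** diagonal c ** transpose Q \<and>
           Y = Q ** diagonal (\<lambda>i. \<bar>c i\<bar>) ** transpose Q)"

definition mat_abs :: "real^'n^'n \<Rightarrow> real^'n^'n"
  where "mat_abs X = (THE Y. is_mat_abs X Y)"

lemma diagonal_mult_nth: "(diagonal c ** B) $ i $ j = c i * B $ i $ j"
  by (simp add: diagonal_def matrix_matrix_mult_def if_distrib [where f = "\<lambda>x. x * _"] cong: if_cong)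

lemma mult_diagonal_nth: "(B ** diagonal c) $ i $ j = B $ i $ j * c j"
  by (simp add: diagonal_def matrix_matrix_mult_def if_distrib [where f = "\<lambda>x. _ * x"] cong: if_cong)

lemma mat_abs_unique:
  assumes "is_mat_abs X Y" "is_mat_abs X Z"
  shows "Y = Z"
proof -
  obtain Q c where Q: "orthogonal_matrix Q" "X = Q ** diagonal c ** transpose Q"
      "Y = Q ** diagonal (\<lambda>i. \<bar>c i\<bar>) ** transpose Q"
    using assms(1) unfolding is_mat_abs_def by blast
  obtain R e where R: "orthogonal_matrix R" "X = R ** diagonal e ** transpose R"
      "Z = R ** diagonal (\<lambda>i. \<bar>e i\<bar>) ** transpose R"
    using assms(2) unfolding is_mat_abs_def by blast
  have o: "transpose Q ** Q = mat 1" "Q ** transpose Q = mat 1"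
    "transpose R ** R = mat 1" "R ** transpose R = mat 1"
    using Q(1) R(1) by (auto simp: orthogonal_matrix_def)
  define S where "S = transpose R ** Q"
  have conj: "S ** diagonal f = diagonal g ** S"
    if "Q ** diagonal f ** transpose Q = R ** diagonal g ** transpose R" for f g
  proof -
    have "S ** diagonal f = transpose R ** (Q ** diagonal f ** transpose Q) ** Q"
      by (metis S_def matrix_mul_assoc matrix_mul_rid o(1))
    also have "\<dots> = diagonal g ** S"
      unfolding that by (metis S_def matrix_mul_assoc matrix_mul_lid o(3))
    finally show ?thesis .
  qed
  have S: "S $ i $ j * c j = e i * S $ i $ j" for i j
    using conj[of c e] Q(2) R(2) by (metis diagonal_mult_nth mult_diagonal_nth)
  have "S $ i $ j * \<bar>c j\<bar> = \<bar>e i\<bar> * S $ i $ j" for i j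
    using S[of i j] by (cases "S $ i $ j = 0") auto
  then have "S ** diagonal (\<lambda>i. \<bar>c i\<bar>) = diagonal (\<lambda>i. \<bar>e i\<bar>) ** S"
    by (simp add: vec_eq_iff diagonal_mult_nth mult_diagonal_nth)
  then have "R ** (S ** diagonal (\<lambda>i. \<bar>c i\<bar>)) ** transpose Q
      = R ** (diagonal (\<lambda>i. \<bar>e i\<bar>) ** S) ** transpose Q"
    by simp
  moreover have "R ** S = Q"
    by (metis S_def matrix_mul_assoc matrix_mul_lid o(4))
  moreover have "S ** transpose Q = transpose R"
    by (metis S_def matrix_mul_assoc matrix_mul_rid o(2))
  ultimately show ?thesis
    using Q(3) R(3) by (metis matrix_mul_assoc)
qed

lemma mat_abs_eq: "is_mat_abs X Y \<Longrightarrow> mat_abs X = Y"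
  unfolding mat_abs_def using mat_abs_unique by blast

definition anticommutator :: "real^'n^'n \<Rightarrow> real^'n^'n \<Rightarrow> real^'n^'n"
  where "anticommutator A B = A ** B + B ** A"

definition mat_integrable :: "'a measure \<Rightarrow> ('a \<Rightarrow> real^'n^'n) \<Rightarrow> bool"
  where "mat_integrable P Y \<longleftrightarrow> (\<forall>i j. integrable P (\<lambda>\<omega>. Y \<omega> $ i $ j))"

definition mat_expectation :: "'a measure \<Rightarrow> ('a \<Rightarrow> real^'n^'n) \<Rightarrow> real^'n^'n"
  where "mat_expectation P Y = (\<chi> i j. \<integral>\<omega>. Y \<omega> $ i $ j \<partial>P)"

text \<open>Sequences are indexed by the integers \<open>n \<ge> 1\<close>; the value \<open>X 0\<close> is never used.\<close>

definition exchangeable :: "'a measure \<Rightarrow> (nat \<Rightarrow> 'a \<Rightarrow> 'b::topological_space) \<Rightarrow> bool"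
  where "exchangeable P X \<longleftrightarrow>
    (\<forall>(k::nat) s t. inj_on s {..<k} \<and> s ` {..<k} \<subseteq> {1..} \<and> inj_on t {..<k} \<and> t ` {..<k} \<subseteq> {1..} \<longrightarrow>
      distr P (\<Pi>\<^sub>M r\<in>{..<k}. borel) (\<lambda>\<omega>. \<lambda>r\<in>{..<k}. X (s r) \<omega>) =
      distr P (\<Pi>\<^sub>M r\<in>{..<k}. borel) (\<lambda>\<omega>. \<lambda>r\<in>{..<k}. X (t r) \<omega>))"

definition sample_mean :: "(nat \<Rightarrow> 'a \<Rightarrow> real^'n^'n) \<Rightarrow> nat \<Rightarrow> 'a \<Rightarrow> real^'n^'n"
  where "sample_mean X n \<omega> = (1 / real n) *\<^sub>R (\<Sum>i=1..n. X i \<omega>)"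

end

theory Submission
  imports Defs
begin

text \<open>
  With \<open>B = A\<inverse>\<close> put \<open>F Z = \<parallel>(Z - M) B\<parallel>\<^sup>2\<close> in the Frobenius norm, a convex function of \<open>Z\<close>.
  If \<open>F Z \<le> 1\<close> then \<open>\<parallel>(Z - M) x\<parallel> \<le> \<parallel>A x\<parallel>\<close> for all \<open>x\<close>, which already forces
  \<open>abs (Z - M) \<preceq> A\<close>: at an eigenvector of \<open>abs (Z - M) - A\<close> with positive eigenvalue the
  inequality would be violated. So it suffices to bound the probability that \<open>F\<close> of some sample
  mean exceeds 1. The sample means of an exchangeable sequence form a reversed martingale, so \<open>F\<close> of
  them is a nonnegative reversed submartingale, and Ville's inequality bounds this probability by
  \<open>\<bbbE> F\<close> of the \<open>N\<close>-th sample mean, which is then a trace computation. The reversed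
  submartingale property is used without conditional expectations: the mean of \<open>n\<close> terms is the
  average of the \<open>n\<close> means of \<open>N\<close> cyclically consecutive terms, and cyclic shifts of the first
  \<open>n\<close> indices preserve both the joint distribution and all partial sums from the \<open>n\<close>-th on.
\<close>

section \<open>Symmetric matrices\<close>

text \<open>For small \<open>t\<close> the linear term dominates the quadratic one, so a nonzero
  \<open>a\<close> would make the sum negative on one side of 0. This serves as the first-order
  condition at the maximiser of a quadratic form.\<close>

lemma quadratic_nonneg_imp_linear_zero:
  fixes a b :: real
  assumes "\<And>t. 0 \<le> 2 * t * a + t\<^sup>2 * b"
  shows "a = 0"
proof (rule ccontr)
  assume "a \<noteq> 0"
  \<comment> \<open>The step is small enough that at \<open>t = - s * a\<close> the linear term
    outweighs the quadratic one, whatever the sign of \<open>b\<close>.\<close>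
  define s where "s = 1 / (1 + \<bar>b\<bar>)"
  have s: "0 < s" "s * b < 2"
    by (auto simp: s_def field_simps)
  have "0 \<le> 2 * (- s * a) * a + (- s * a)\<^sup>2 * b"
    by (rule assms)
  also have "\<dots> = s * a\<^sup>2 * (s * b - 2)"
    by (simp add: power2_eq_square algebra_simps)
  also have "\<dots> < 0"
    using s \<open>a \<noteq> 0\<close> by (intro mult_pos_neg) auto
  finally show False by simp
qed

text \<open>By compactness the quadratic form has a maximiser \<open>u\<close> on the unit sphere of
  \<open>W\<close>, and stationarity there makes \<open>u\<close> an eigenvector. The closing
  inequality records that \<open>l\<close> is the largest value of the form, which the criterion for
  the Loewner order uses.\<close>

lemma self_adjoint_top_eigenvector:
  fixes f :: "'a::euclidean_space \<Rightarrow> 'a"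
  assumes "linear f" and sa: "\<And>x y. f x \<bullet> y = x \<bullet> f y"
    and W: "subspace W" "f ` W \<subseteq> W" "W \<noteq> {0}"
  obtains u l where "u \<in> W" "norm u = 1" "f u = l *\<^sub>R u"
    "\<And>w. w \<in> W \<Longrightarrow> w \<bullet> f w \<le> l * (norm w)\<^sup>2"
proof -
  interpret f: linear f by fact
  let ?S = "sphere 0 1 \<inter> W"
  obtain w0 where w0: "w0 \<in> W" "w0 \<noteq> 0"
    using W subspace_0 by blast
  then have "(1 / norm w0) *\<^sub>R w0 \<in> ?S"
    using W(1) by (simp add: subspace_scale)
  moreover have "compact ?S"
    by (intro compact_Int_closed closed_subspace W) auto
  moreover have "continuous_on ?S (\<lambda>x. x \<bullet> f x)"
    by (intro continuous_intros linear_continuous_on linear_conv_bounded_linear[THEN iffD1] assms)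
  ultimately obtain u where u: "u \<in> W" "norm u = 1"
    and max: "\<And>y. y \<in> W \<Longrightarrow> norm y = 1 \<Longrightarrow> y \<bullet> f y \<le> u \<bullet> f u"
    using continuous_attains_sup[of ?S "\<lambda>x. x \<bullet> f x"] by (metis IntD1 IntD2 IntI empty_iff mem_sphere_0)
  define l where "l = u \<bullet> f u"
  have le: "w \<bullet> f w \<le> l * (norm w)\<^sup>2" if "w \<in> W" for w
  proof (cases "w = 0")
    case False
    have "((1 / norm w) *\<^sub>R w) \<bullet> f ((1 / norm w) *\<^sub>R w) \<le> l"
      unfolding l_def using False that W(1) by (intro max) (auto simp: subspace_scale)
    then show ?thesis
      using False by (simp add: f.scale field_simps power2_eq_square)
  qed (simp add: f.zero)
  \<comment> \<open>\<open>v\<close> is the residual of the eigenvector equation. Moving from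
    \<open>u\<close> to \<open>u + t *\<^sub>R v\<close>, which stays in \<open>W\<close>, changes
    the nonnegative quantity \<open>l * (norm w)\<^sup>2 - w \<bullet> f w\<close> from 0 by
    \<open>2 * t * (v \<bullet> v)\<close> to first order.\<close>
  define v where "v = l *\<^sub>R u - f u"
  have v: "v \<in> W"
    using u W by (auto simp: v_def intro!: subspace_diff subspace_scale)
  have uu: "u \<bullet> u = 1"
    using u(2) by (simp add: norm_eq_1)
  have "v \<bullet> v = 0"
  proof (rule quadratic_nonneg_imp_linear_zero)
    fix t :: real
    have "u + t *\<^sub>R v \<in> W"
      using u v W by (auto intro!: subspace_add subspace_scale)
    moreover have "(norm (u + t *\<^sub>R v))\<^sup>2 = u \<bullet> u + 2 * t * (u \<bullet> v) + t\<^sup>2 * (v \<bullet> v)"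
      unfolding power2_norm_eq_inner
      by (simp add: inner_add_left inner_add_right inner_commute[of v u] power2_eq_square algebra_simps)
    ultimately have ge:
      "l * (u \<bullet> u + 2 * t * (u \<bullet> v) + t\<^sup>2 * (v \<bullet> v))
        - (u \<bullet> f u + t * (u \<bullet> f v) + t * (v \<bullet> f u) + t\<^sup>2 * (v \<bullet> f v)) \<ge> 0"
      using le[of "u + t *\<^sub>R v"]
      by (simp add: f.add f.scale inner_add_left inner_add_right power2_eq_square algebra_simps)
    have 1: "v \<bullet> f u = f u \<bullet> v"
      by (rule inner_commute)
    have 2: "f u \<bullet> v = l * (u \<bullet> v) - v \<bullet> v"
      by (subst (3) v_def) (simp add: inner_diff_left)
    show "0 \<le> 2 * t * (v \<bullet> v) + t\<^sup>2 * (l * (v \<bullet> v) - v \<bullet> f v)"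
      using ge unfolding sa[symmetric, of u] 1 2 uu by (simp add: inner_commute[of "f u" u] l_def[symmetric] algebra_simps)
  qed
  then have "f u = l *\<^sub>R u"
    by (simp add: v_def)
  with u le show thesis
    using that by blast
qed

text \<open>Induction on the dimension: split off a unit eigenvector \<open>u\<close>; its
  orthogonal complement in \<open>W\<close> is again invariant because the map is self-adjoint. The
  general invariant subspace \<open>W\<close> makes this induction possible.\<close>

lemma self_adjoint_orthonormal_eigenbasis:
  fixes f :: "'a::euclidean_space \<Rightarrow> 'a"
  assumes "linear f" and sa: "\<And>x y. f x \<bullet> y = x \<bullet> f y"
    and "subspace W" "f ` W \<subseteq> W"
  shows "\<exists>B. pairwise orthogonal B \<and> (\<forall>b\<in>B. norm b = 1 \<and> (\<exists>l. f b = l *\<^sub>R b)) \<and> span B = W"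
  using assms(3,4)
proof (induction "dim W" arbitrary: W rule: less_induct)
  case less
  show ?case
  proof (cases "W = {0}")
    case True
    then show ?thesis by (intro exI[of _ "{}"]) auto
  next
    case False
    obtain u l where u: "u \<in> W" "norm u = 1" "f u = l *\<^sub>R u"
      using self_adjoint_top_eigenvector[OF assms(1,2) less.prems False] by metis
    define W' where "W' = W \<inter> {w. u \<bullet> w = 0}"
    have sub: "subspace W'"
      unfolding W'_def by (intro subspace_inter less.prems subspace_hyperplane)
    have inv: "f ` W' \<subseteq> W'"
    proof -
      have "u \<bullet> f w = 0" if "u \<bullet> w = 0" for w
        using that by (simp add: sa[symmetric] u(3))
      then show ?thesis
        using less.prems(2) by (auto simp: W'_def)
    qed
    have "u \<bullet> u = 1"
      using u(2) by (simp add: norm_eq_1)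
    then have "u \<notin> W'" by (simp add: W'_def)
    then have "W' \<subset> W"
      using u(1) unfolding W'_def by blast
    then have "dim W' < dim W"
      using sub less.prems(1) by (metis dim_psubset span_eq_iff)
    from less.hyps[OF this sub inv] obtain B
      where B: "pairwise orthogonal B" "\<And>b. b \<in> B \<Longrightarrow> norm b = 1 \<and> (\<exists>l. f b = l *\<^sub>R b)"
        "span B = W'"
      by blast
    have BW: "b \<in> W" "u \<bullet> b = 0" if "b \<in> B" for b
      using that span_base[of b B] B(3) by (auto simp: W'_def)
    have "pairwise orthogonal (insert u B)"
      using B(1) BW(2) by (auto simp: pairwise_insert orthogonal_def inner_commute)
    moreover have "span (insert u B) = W"
    proof
      show "span (insert u B) \<subseteq> W"
        using u(1) BW(1) less.prems(1) by (intro span_minimal) auto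
      show "W \<subseteq> span (insert u B)"
      proof
        fix w assume "w \<in> W"
        then have "w - (u \<bullet> w) *\<^sub>R u \<in> W'"
          using u(1) less.prems(1) \<open>u \<bullet> u = 1\<close>
          by (auto simp: W'_def inner_diff_right intro!: subspace_diff subspace_scale)
        then show "w \<in> span (insert u B)"
          unfolding span_insert B(3) by blast
      qed
    qed
    ultimately show ?thesis
      using B(2) u by (intro exI[of _ "insert u B"]) auto
  qed
qed

lemma sym_mats_inner:
  fixes S :: "real^'n^'n"
  assumes "S \<in> sym_mats"
  shows "(S *v x) \<bullet> y = x \<bullet> (S *v y)"
  using assms dot_lmul_matrix[of x S y] by (simp add: sym_mats_def transpose_matrix_vector[symmetric])

text \<open>The orthonormal eigenvectors become the columns of \<open>Q\<close>; then
  \<open>S ** Q = Q ** diagonal c\<close> is the eigenvector equation read column by column.\<close>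

lemma sym_mats_diagonalization:
  fixes S :: "real^'n^'n"
  assumes "S \<in> sym_mats"
  obtains Q c where "orthogonal_matrix Q" "S = Q ** diagonal c ** transpose Q"
proof -
  obtain B where B: "pairwise orthogonal B" "\<And>b. b \<in> B \<Longrightarrow> norm b = 1 \<and> (\<exists>l. S *v b = l *\<^sub>R b)"
      "span B = UNIV"
    using self_adjoint_orthonormal_eigenbasis[of "(*v) S" UNIV, OF matrix_vector_mul_linear
        sym_mats_inner[OF assms] subspace_UNIV subset_UNIV]
    by auto
  have ind: "independent B"
    using B(1,2) by (intro pairwise_orthogonal_independent) force+
  then have "card B = CARD('n)" "finite B"
    using basis_card_eq_dim[of B UNIV] B(3) independent_imp_finite by auto
  \<comment> \<open>The basis has as many elements as the index type, so it can be enumerated by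
    \<open>'n\<close>.\<close>
  then obtain g where g: "bij_betw g (UNIV :: 'n set) B"
    by (metis finite_class.finite_UNIV finite_same_card_bij)
  then have gB: "g i \<in> B" for i
    by (auto simp: bij_betw_def)
  obtain c where c: "\<And>i. S *v g i = c i *\<^sub>R g i"
    using B(2)[OF gB] by metis
  define Q :: "real^'n^'n" where "Q = (\<chi> i j. g j $ i)"
  have col: "column j Q = g j" for j
    by (simp add: Q_def column_def vec_eq_iff)
  have Q: "orthogonal_matrix Q"
    unfolding orthogonal_matrix_orthonormal_columns col
    using B(1,2) gB g by (auto simp: bij_betw_def pairwise_def inj_eq)
  have "S ** Q = Q ** diagonal c"
  proof -
    have "(S ** Q) $ i $ j = (S *v g j) $ i" for i j
      by (simp add: matrix_matrix_mult_def matrix_vector_mult_def Q_def)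
    then show ?thesis
      by (simp add: vec_eq_iff mult_diagonal_nth c Q_def)
  qed
  then have "S = Q ** diagonal c ** transpose Q"
    using Q by (metis matrix_mul_assoc matrix_mul_rid orthogonal_matrix_def)
  with Q show thesis using that by blast
qed

section \<open>The absolute value of a symmetric matrix\<close>

lemma diagonal_mult_vec_nth: "(diagonal c *v x) $ i = c i * x $ i"
  by (simp add: diagonal_def matrix_vector_mult_def if_distrib [where f = "\<lambda>x. x * _"] cong: if_cong)

lemma transpose_diagonal: "transpose (diagonal c) = diagonal c"
  by (auto simp: vec_eq_iff transpose_def diagonal_def)

text \<open>\<open>Q\<close> preserves norms, and \<open>c i\<close> and its modulus scale a
  coordinate to the same length. These two facts are what the later argument uses of
  \<open>mat_abs\<close>.\<close>

lemma mat_abs_properties: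
  fixes S :: "real^'n^'n"
  assumes "S \<in> sym_mats"
  shows mat_abs_sym: "mat_abs S \<in> sym_mats"
    and norm_mat_abs_mult: "norm (mat_abs S *v x) = norm (S *v x)"
proof -
  obtain Q c where Q: "orthogonal_matrix Q" and S: "S = Q ** diagonal c ** transpose Q"
    using sym_mats_diagonalization[OF assms] .
  have D: "mat_abs S = Q ** diagonal (\<lambda>i. \<bar>c i\<bar>) ** transpose Q"
    using Q S by (intro mat_abs_eq) (auto simp: is_mat_abs_def)
  show "mat_abs S \<in> sym_mats"
    by (simp add: D sym_mats_def matrix_transpose_mul transpose_diagonal matrix_mul_assoc)
  have norm_Q: "norm (Q *v y) = norm y" for y
    using Q orthogonal_transformation_norm orthogonal_transformation_matrix
    by (metis matrix_of_matrix_vector_mul matrix_vector_mul_linear)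
  have "norm (diagonal (\<lambda>i. \<bar>c i\<bar>) *v y) = norm (diagonal c *v y)" for y
    by (simp add: norm_vec_def diagonal_mult_vec_nth abs_mult)
  then show "norm (mat_abs S *v x) = norm (S *v x)"
    unfolding D unfolding S by (simp add: norm_Q flip: matrix_vector_mul_assoc)
qed

section \<open>Loewner order, Frobenius norm and traces\<close>

text \<open>Suppose the largest eigenvalue \<open>l\<close> of \<open>D - A\<close> were positive,
  with unit eigenvector \<open>u\<close>. Then \<open>D *v u\<close> is
  \<open>A *v u + l *\<^sub>R u\<close>, whose squared norm is at least
  \<open>(norm (A *v u))\<^sup>2 + l\<^sup>2\<close> because \<open>A\<close> is positive
  semidefinite, contrary to the norm bound.\<close>

lemma loewner_leI_norm:
  fixes D A :: "real^'n^'n"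
  assumes D: "D \<in> sym_mats" and A: "A \<in> psd_mats"
    and le: "\<And>x. norm (D *v x) \<le> norm (A *v x)"
  shows "D \<preceq> A"
proof -
  have As: "A \<in> sym_mats"
    using A by (simp add: psd_mats_def)
  have diff: "D - A \<in> sym_mats" "A - D \<in> sym_mats"
    using D As by (auto simp: sym_mats_def transpose_def vec_eq_iff)
  obtain u l where u: "norm u = 1" "(D - A) *v u = l *\<^sub>R u"
    and l: "\<And>w. w \<bullet> ((D - A) *v w) \<le> l * (norm w)\<^sup>2"
    using self_adjoint_top_eigenvector[of "(*v) (D - A)" UNIV, OF matrix_vector_mul_linear
        sym_mats_inner[OF diff(1)] subspace_UNIV subset_UNIV] UNIV_not_singleton
    by (metis UNIV_I)
  have "l \<le> 0"
  proof (rule ccontr)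
    assume "\<not> l \<le> 0"
    have Du: "D *v u = A *v u + l *\<^sub>R u"
      using u(2) by (simp add: matrix_vector_mult_diff_rdistrib algebra_simps)
    have "0 \<le> l * (u \<bullet> (A *v u))"
      using A \<open>\<not> l \<le> 0\<close> by (auto simp: psd_mats_def)
    moreover have "0 < l\<^sup>2"
      using \<open>\<not> l \<le> 0\<close> by simp
    moreover have "(norm (D *v u))\<^sup>2 = (norm (A *v u))\<^sup>2 + 2 * (l * (u \<bullet> (A *v u))) + l\<^sup>2"
      using u(1) unfolding Du power2_norm_eq_inner norm_eq_1
      by (simp add: inner_add_left inner_add_right inner_commute power2_eq_square algebra_simps)
    moreover have "(norm (D *v u))\<^sup>2 \<le> (norm (A *v u))\<^sup>2"
      by (intro power_mono le) auto
    ultimately show False by linarith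
  qed
  then have "w \<bullet> ((D - A) *v w) \<le> 0" for w
    using l[of w] by (smt (verit) mult_nonpos_nonneg zero_le_power2)
  then have "0 \<le> w \<bullet> ((A - D) *v w)" for w
    by (smt (verit) inner_diff_right matrix_vector_mult_diff_rdistrib)
  with diff(2) show ?thesis
    by (simp add: loewner_le_def psd_mats_def)
qed

text \<open>Cauchy-Schwarz in each row. The norm of the nested vector type is the Frobenius norm,
  which thus dominates the operator norm.\<close>

lemma norm_matrix_vector_mult_le:
  fixes A :: "real^'n^'m"
  shows "norm (A *v x) \<le> norm A * norm x"
proof -
  have "norm (A *v x) = L2_set (\<lambda>i. \<bar>A $ i \<bullet> x\<bar>) UNIV"
    by (simp add: norm_vec_def matrix_vector_mul_component)
  also have "\<dots> \<le> L2_set (\<lambda>i. norm (A $ i) * norm x) UNIV"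
    by (intro L2_set_mono Cauchy_Schwarz_ineq2) auto
  also have "\<dots> = norm A * norm x"
    by (simp add: norm_vec_def[of A] L2_set_left_distrib)
  finally show ?thesis .
qed

lemma inner_matrix_eq_trace:
  fixes Y Z :: "real^'n^'m"
  shows "Y \<bullet> Z = trace (transpose Y ** Z)"
proof -
  have "Y \<bullet> Z = (\<Sum>i\<in>UNIV. \<Sum>j\<in>UNIV. Y $ i $ j * Z $ i $ j)"
    by (simp add: inner_vec_def)
  also have "\<dots> = (\<Sum>j\<in>UNIV. \<Sum>i\<in>UNIV. Y $ i $ j * Z $ i $ j)"
    by (rule sum.swap)
  also have "\<dots> = trace (transpose Y ** Z)"
    by (simp add: trace_def matrix_matrix_mult_def transpose_def)
  finally show ?thesis .
qed

text \<open>Cyclicity of the trace. Frobenius products become linear in \<open>Y ** Z\<close>, so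
  that expectations can be taken inside the trace.\<close>

lemma inner_sym_mult_eq_trace:
  fixes Y Z B :: "real^'n^'n"
  assumes "Y \<in> sym_mats" "B \<in> sym_mats"
  shows "(Y ** B) \<bullet> (Z ** B) = trace ((Y ** Z) ** (B ** B))"
proof -
  have "(Y ** B) \<bullet> (Z ** B) = trace (B ** (Y ** Z ** B))"
    using assms by (simp add: inner_matrix_eq_trace matrix_transpose_mul sym_mats_def matrix_mul_assoc)
  also have "\<dots> = trace ((Y ** Z ** B) ** B)"
    by (rule trace_mul_sym)
  finally show ?thesis
    by (simp add: matrix_mul_assoc)
qed

text \<open>Definiteness makes the kernel trivial. The transposed inverse is also a left inverse of
  the symmetric \<open>A\<close>, hence equal to the inverse.\<close>

lemma pd_mats_inverse:
  fixes A :: "real^'n^'n"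
  assumes "A \<in> pd_mats"
  shows "A ** matrix_inv A = mat 1" "matrix_inv A ** A = mat 1" "matrix_inv A \<in> sym_mats"
proof -
  have "x = 0" if "A *v x = 0" for x
    using assms that by (force simp: pd_mats_def)
  then have "invertible A"
    by (metis invertible_left_inverse matrix_left_invertible_ker)
  then show 1: "A ** matrix_inv A = mat 1" and 2: "matrix_inv A ** A = mat 1"
    unfolding invertible_def matrix_inv_def by (metis (mono_tags, lifting) someI_ex)+
  have "transpose (matrix_inv A) ** A = mat 1"
    using arg_cong[OF 1, of transpose] assms
    by (simp add: matrix_transpose_mul pd_mats_def sym_mats_def transpose_mat)
  then show "matrix_inv A \<in> sym_mats"
    using 1 matrix_mul_assoc[of "transpose (matrix_inv A)" A "matrix_inv A"] by (simp add: sym_mats_def)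
qed

text \<open>Since \<open>S *v x\<close> is \<open>S ** matrix_inv A\<close> applied to
  \<open>A *v x\<close>, a Frobenius norm of at most 1 gives
  \<open>norm (S *v x) \<le> norm (A *v x)\<close>, and \<open>mat_abs S\<close> has the same norms
  as \<open>S\<close>.\<close>

lemma mat_abs_loewner_leI:
  fixes S A :: "real^'n^'n"
  assumes S: "S \<in> sym_mats" and A: "A \<in> pd_mats" and le: "norm (S ** matrix_inv A) \<le> 1"
  shows "mat_abs S \<preceq> A"
proof (rule loewner_leI_norm)
  show "mat_abs S \<in> sym_mats"
    by (rule mat_abs_sym[OF S])
  have "0 \<le> x \<bullet> (A *v x)" for x
    using A by (cases "x = 0") (auto simp: pd_mats_def less_imp_le)
  then show "A \<in> psd_mats"
    using A by (simp add: pd_mats_def psd_mats_def)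
  fix x
  have "S *v x = (S ** matrix_inv A) *v (A *v x)"
    by (simp add: matrix_vector_mul_assoc pd_mats_inverse(2)[OF A] matrix_mul_assoc[symmetric])
  then have "norm (S *v x) \<le> norm (S ** matrix_inv A) * norm (A *v x)"
    by (simp only: norm_matrix_vector_mult_le)
  also have "\<dots> \<le> norm (A *v x)"
    using le by (simp add: mult_left_le_one_le)
  finally show "norm (mat_abs S *v x) \<le> norm (A *v x)"
    by (simp add: norm_mat_abs_mult[OF S])
qed

text \<open>By cyclicity the difference of the traces is the trace of
  \<open>transpose B ** (V - W) ** B\<close>, whose diagonal entries are values of a nonnegative
  quadratic form at the columns of \<open>B\<close>.\<close>

lemma trace_mult_mono:
  fixes V W B :: "real^'n^'n"
  assumes "W \<preceq> V" "B \<in> sym_mats"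
  shows "trace (W ** (B ** B)) \<le> trace (V ** (B ** B))"
proof -
  let ?D = "V - W"
  have "0 \<le> column i B \<bullet> (?D *v column i B)" for i
    using assms(1) by (auto simp: loewner_le_def psd_mats_def)
  moreover have "column i B \<bullet> (?D *v column i B) = (transpose B ** ?D ** B) $ i $ i" for i
    unfolding matrix_mult_transpose_dot_column matrix_mul_assoc[symmetric]
    by (simp add: inner_vec_def column_def matrix_matrix_mult_def matrix_vector_mult_def transpose_def)
  ultimately have "0 \<le> trace (transpose B ** ?D ** B)"
    by (simp add: trace_def sum_nonneg)
  also have "\<dots> = trace (?D ** (B ** transpose B))"
    by (metis matrix_mul_assoc trace_mul_sym)
  also have "\<dots> = trace (V ** (B ** B)) - trace (W ** (B ** B))"
    using assms(2) by (simp add: sym_mats_def matrix_matrix_mult_def trace_def sum_subtractf algebra_simps)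
  finally show ?thesis by simp
qed



section \<open>Exchangeable sequences\<close>

lemma exchangeable_nn_integral:
  fixes X :: "nat \<Rightarrow> 'a \<Rightarrow> 'b::{second_countable_topology}" and g :: "(nat \<Rightarrow> 'b) \<Rightarrow> ennreal"
  assumes "exchangeable P X" and X: "\<And>n. n \<ge> 1 \<Longrightarrow> X n \<in> borel_measurable P"
    and st: "inj_on s {..<k}" "s ` {..<k} \<subseteq> {1..}" "inj_on t {..<k}" "t ` {..<k} \<subseteq> {1..}"
    and g: "g \<in> borel_measurable (\<Pi>\<^sub>M r\<in>{..<k}. borel)"
  shows "(\<integral>\<^sup>+\<omega>. g (\<lambda>r\<in>{..<k}. X (s r) \<omega>) \<partial>P) = (\<integral>\<^sup>+\<omega>. g (\<lambda>r\<in>{..<k}. X (t r) \<omega>) \<partial>P)"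
proof -
  have meas: "(\<lambda>\<omega>. \<lambda>r\<in>{..<k}. X (s r) \<omega>) \<in> P \<rightarrow>\<^sub>M (\<Pi>\<^sub>M r\<in>{..<k}. borel)"
    if "s ` {..<k} \<subseteq> {1..}" for s
    using that by (intro measurable_restrict X) auto
  have "distr P (\<Pi>\<^sub>M r\<in>{..<k}. borel) (\<lambda>\<omega>. \<lambda>r\<in>{..<k}. X (s r) \<omega>) =
      distr P (\<Pi>\<^sub>M r\<in>{..<k}. borel) (\<lambda>\<omega>. \<lambda>r\<in>{..<k}. X (t r) \<omega>)"
    using assms(1) st unfolding exchangeable_def by blast
  then show ?thesis
    using nn_integral_distr[OF meas[OF st(2)], of g] nn_integral_distr[OF meas[OF st(4)], of g] g
    by simp
qed

text \<open>Take \<open>k = 1\<close> and project to the single coordinate. This carries moment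
  assumptions on \<open>X 1\<close> over to every \<open>X i\<close>.\<close>

lemma exchangeable_identically_distributed:
  fixes X :: "nat \<Rightarrow> 'a \<Rightarrow> 'b::second_countable_topology"
  assumes "exchangeable P X" and X: "\<And>n. n \<ge> 1 \<Longrightarrow> X n \<in> borel_measurable P"
    and ij: "i \<ge> 1" "j \<ge> 1"
  shows "distr P borel (X i) = distr P borel (X j)"
proof -
  let ?M = "\<Pi>\<^sub>M r\<in>{..<1::nat}. borel :: 'b measure"
  have meas: "(\<lambda>\<omega>. \<lambda>r\<in>{..<1::nat}. X i \<omega>) \<in> P \<rightarrow>\<^sub>M ?M" if "i \<ge> 1" for i
    using that by (intro measurable_restrict X) auto
  have proj: "(\<lambda>f. f 0) \<in> ?M \<rightarrow>\<^sub>M borel"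
    by (rule measurable_component_singleton) auto
  have eq: "distr P borel (X i) = distr (distr P ?M (\<lambda>\<omega>. \<lambda>r\<in>{..<1::nat}. X i \<omega>)) borel (\<lambda>f. f 0)"
    if "i \<ge> 1" for i
    by (subst distr_distr[OF proj meas[OF that]]) (simp add: comp_def)
  have "distr P ?M (\<lambda>\<omega>. \<lambda>r\<in>{..<1::nat}. X i \<omega>) = distr P ?M (\<lambda>\<omega>. \<lambda>r\<in>{..<1::nat}. X j \<omega>)"
    using assms(1)[unfolded exchangeable_def, THEN spec[of _ 1], THEN spec[of _ "\<lambda>_. i"],
        THEN spec[of _ "\<lambda>_. j"]] ij by (auto simp: inj_on_def)
  then show ?thesis
    unfolding eq[OF ij(1)] eq[OF ij(2)] by simp
qed

section \<open>Cyclic shifts\<close>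

text \<open>\<open>n\<close> divides the difference of the two numbers, which is smaller than
  \<open>n\<close>. It is applied both to different shifts of one position and to different
  positions under one shift.\<close>

lemma add_mod_left_inject:
  fixes r c c' n :: nat
  assumes "(r + c) mod n = (r + c') mod n" "c < n" "c' < n"
  shows "c = c'"
  using assms
proof (induction c c' rule: linorder_wlog)
  case (le c c')
  then have "n dvd c' - c"
    using mod_eq_dvd_iff_nat[of "r + c" "r + c'" n] by simp
  with le show ?case
    using nat_dvd_not_less[of "c' - c" n] by fastforce
qed simp

lemma sum_cyclic_shifts:
  fixes x :: "nat \<Rightarrow> 'b::comm_monoid_add"
  assumes "0 < n"
  shows "(\<Sum>c<n. x ((r + c) mod n)) = (\<Sum>i<n. x i)"
proof (rule sum.reindex_bij_betw)
  have "inj_on (\<lambda>c. (r + c) mod n) {..<n}"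
    by (auto intro!: inj_onI dest: add_mod_left_inject)
  then show "bij_betw (\<lambda>c. (r + c) mod n) {..<n} {..<n}"
    using assms by (intro bij_betw_imageI endo_inj_surj) auto
qed

text \<open>Jensen's inequality with equal weights on the \<open>n\<close> cyclic windows of length
  \<open>N\<close>. Each of the \<open>n\<close> terms lies in exactly \<open>N\<close> windows, so
  the window means average to the full mean.\<close>

lemma convex_on_mean_cyclic_shifts:
  fixes F :: "'b::real_vector \<Rightarrow> real" and x :: "nat \<Rightarrow> 'b"
  assumes F: "convex_on UNIV F" and N: "1 \<le> N" "N \<le> n"
  shows "F ((1 / real n) *\<^sub>R (\<Sum>i<n. x i))
    \<le> (\<Sum>c<n. (1 / real n) * F ((1 / real N) *\<^sub>R (\<Sum>r<N. x ((r + c) mod n))))"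
proof -
  have "(\<Sum>c<n. (1 / real n) *\<^sub>R ((1 / real N) *\<^sub>R (\<Sum>r<N. x ((r + c) mod n))))
      = (1 / real n) *\<^sub>R (1 / real N) *\<^sub>R (\<Sum>c<n. \<Sum>r<N. x ((r + c) mod n))"
    by (simp add: scaleR_sum_right)
  \<comment> \<open>At a fixed window position \<open>r\<close>, the inner sum over the start
    \<open>c\<close> meets every term once.\<close>
  also have "(\<Sum>c<n. \<Sum>r<N. x ((r + c) mod n)) = (\<Sum>r<N. \<Sum>c<n. x ((r + c) mod n))"
    by (rule sum.swap)
  also have "\<dots> = (\<Sum>r<N. \<Sum>i<n. x i)"
    using N by (intro sum.cong refl sum_cyclic_shifts) auto
  also have "(1 / real n) *\<^sub>R (1 / real N) *\<^sub>R \<dots> = (1 / real n) *\<^sub>R (\<Sum>i<n. x i)"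
    using N by (simp add: sum_constant_scaleR)
  finally show ?thesis
    using convex_on_sum[of "{..<n}" UNIV F "\<lambda>_. 1 / real n"
        "\<lambda>c. (1 / real N) *\<^sub>R (\<Sum>r<N. x ((r + c) mod n))"] F N by (simp add: lessThan_empty_iff)
qed

section \<open>Reversed submartingale property and maximal inequality\<close>

text \<open>Testing against an arbitrary \<open>G\<close> of the partial sums from \<open>n\<close>
  to \<open>K\<close> replaces conditioning on them. The left integrand is bounded pathwise by an
  average over cyclic windows of length \<open>N\<close>; rotations leave \<open>G\<close>
  unchanged, and by exchangeability all windows contribute the same integral.\<close>

lemma exchangeable_nn_integral_mean_le:
  fixes X :: "nat \<Rightarrow> 'a \<Rightarrow> 'b::{real_normed_vector, second_countable_topology}"
    and F :: "'b \<Rightarrow> real"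
  assumes ex: "exchangeable P X" and X: "\<And>n. n \<ge> 1 \<Longrightarrow> X n \<in> borel_measurable P"
    and F: "convex_on UNIV F" "F \<in> borel_measurable borel" "\<And>x. 0 \<le> F x"
    and N: "1 \<le> N" "N \<le> n" "n \<le> K"
    and G: "G \<in> borel_measurable (\<Pi>\<^sub>M r\<in>{n..K}. borel)"
  defines "S \<equiv> \<lambda>\<omega> m. \<Sum>i=1..m. X i \<omega>"
  shows "(\<integral>\<^sup>+\<omega>. ennreal (F ((1 / real n) *\<^sub>R S \<omega> n)) * G (\<lambda>m\<in>{n..K}. S \<omega> m) \<partial>P)
       \<le> (\<integral>\<^sup>+\<omega>. ennreal (F ((1 / real N) *\<^sub>R S \<omega> N)) * G (\<lambda>m\<in>{n..K}. S \<omega> m) \<partial>P)"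
proof -
  define T where "T x = (\<lambda>m\<in>{n..K}. \<Sum>r<m. x r)" for x :: "nat \<Rightarrow> 'b"
  define H where "H x = ennreal (F ((1 / real N) *\<^sub>R (\<Sum>r<N. x r))) * G (T x)" for x :: "nat \<Rightarrow> 'b"
  \<comment> \<open>\<open>s c\<close> rotates the first \<open>n\<close> positions by
    \<open>c\<close> and fixes the later ones; the \<open>+ 1\<close> turns positions counted from 0
    into indices counted from 1.\<close>
  define s where "s c r = (if r < n then (r + c) mod n + 1 else r + 1)" for c r
  define Y where "Y c \<omega> = (\<lambda>r\<in>{..<K}. X (s c r) \<omega>)" for c \<omega>
  define Y0 where "Y0 \<omega> = (\<lambda>r\<in>{..<K}. X (r + 1) \<omega>)" for \<omega>
  have n: "0 < n" using N by simp
  have s: "inj_on (s c) {..<K}" "s c ` {..<K} \<subseteq> {1..}" for c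
  proof -
    show "inj_on (s c) {..<K}"
    proof (rule inj_onI)
      fix r r' assume *: "r \<in> {..<K}" "r' \<in> {..<K}" "s c r = s c r'"
      have "(r + c) mod n < n" "(r' + c) mod n < n"
        using n by auto
      with *(3) have "r < n \<longleftrightarrow> r' < n"
        by (auto simp: s_def split: if_splits)
      moreover have "r = r'" if "r < n" "r' < n"
        using *(3) that by (auto simp: s_def add.commute[of _ c] dest: add_mod_left_inject)
      ultimately show "r = r'"
        using *(3) by (auto simp: s_def split: if_splits)
    qed
  qed (auto simp: s_def)
  have id: "inj_on (\<lambda>r. r + 1) {..<K}" "(\<lambda>r. r + 1) ` {..<K} \<subseteq> {1..}"
    by auto
  have T_meas: "T \<in> (\<Pi>\<^sub>M r\<in>{..<K}. borel) \<rightarrow>\<^sub>M (\<Pi>\<^sub>M r\<in>{n..K}. borel)"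
    unfolding T_def
    by (intro measurable_restrict borel_measurable_sum measurable_component_singleton) auto
  have sum_meas: "(\<lambda>x. \<Sum>r<N. x r) \<in> borel_measurable (\<Pi>\<^sub>M r\<in>{..<K}. borel :: 'b measure)"
    using N by (intro borel_measurable_sum measurable_component_singleton) auto
  have H_meas: "H \<in> borel_measurable (\<Pi>\<^sub>M r\<in>{..<K}. borel)"
    unfolding H_def
    by (intro borel_measurable_times_ennreal measurable_compose[OF T_meas G]
        measurable_compose[OF _ measurable_ennreal] measurable_compose[OF _ F(2)]
        borel_measurable_scaleR borel_measurable_const sum_meas)
  have Y_meas: "Y c \<in> P \<rightarrow>\<^sub>M (\<Pi>\<^sub>M r\<in>{..<K}. borel)" for c
    unfolding Y_def using s(2)[of c] by (intro measurable_restrict X) auto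
  have S_eq: "S \<omega> m = (\<Sum>r<m. Y0 \<omega> r)" if "m \<le> K" for \<omega> m
  proof -
    have "S \<omega> m = (\<Sum>r<m. X (r + 1) \<omega>)"
      unfolding S_def by (simp add: sum.atLeast1_atMost_eq)
    then show ?thesis
      using that by (simp add: Y0_def)
  qed
  have Y_low: "Y c \<omega> r = Y0 \<omega> ((r + c) mod n)" if "r < n" for c \<omega> r
  proof -
    have "(r + c) mod n < K"
      using mod_less_divisor[OF n, of "r + c"] N by linarith
    then show ?thesis
      using that N by (simp add: Y_def Y0_def s_def)
  qed
  \<comment> \<open>A partial sum of at least \<open>n\<close> terms contains the whole rotated
    block, so the rotation does not change it.\<close>
  have T_Y: "T (Y c \<omega>) = T (Y0 \<omega>)" for c \<omega>
  proof -
    have "(\<Sum>r<m. Y c \<omega> r) = (\<Sum>r<m. Y0 \<omega> r)" if "m \<in> {n..K}" for m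
    proof -
      have split: "(\<Sum>r<m. f r) = (\<Sum>r<n. f r) + (\<Sum>r\<in>{n..<m}. f r)" for f :: "nat \<Rightarrow> 'b"
        using that by (simp add: lessThan_atLeast0 sum.atLeastLessThan_concat)
      have "(\<Sum>r<n. Y c \<omega> r) = (\<Sum>r<n. Y0 \<omega> r)"
        using sum_cyclic_shifts[OF n, of "Y0 \<omega>" c] by (simp add: Y_low add.commute)
      moreover have "(\<Sum>r\<in>{n..<m}. Y c \<omega> r) = (\<Sum>r\<in>{n..<m}. Y0 \<omega> r)"
        using that by (intro sum.cong) (auto simp: Y_def Y0_def s_def)
      ultimately show ?thesis
        unfolding split by simp
    qed
    then show ?thesis
      by (auto simp: T_def)
  qed
  have T_S: "(\<lambda>m\<in>{n..K}. S \<omega> m) = T (Y0 \<omega>)" for \<omega>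
    by (auto simp: T_def S_eq)
  have "ennreal (F ((1 / real n) *\<^sub>R S \<omega> n)) * G (T (Y0 \<omega>))
      \<le> (\<Sum>c<n. ennreal (1 / real n) * H (Y c \<omega>))" for \<omega>
  proof -
    have "F ((1 / real n) *\<^sub>R S \<omega> n)
        \<le> (\<Sum>c<n. (1 / real n) * F ((1 / real N) *\<^sub>R (\<Sum>r<N. Y c \<omega> r)))"
      using convex_on_mean_cyclic_shifts[OF F(1) N(1,2), of "Y0 \<omega>"] N by (simp add: Y_low S_eq)
    then have "ennreal (F ((1 / real n) *\<^sub>R S \<omega> n))
        \<le> (\<Sum>c<n. ennreal (1 / real n) * ennreal (F ((1 / real N) *\<^sub>R (\<Sum>r<N. Y c \<omega> r))))"
      by (simp add: ennreal_leI F(3) sum_ennreal flip: ennreal_mult')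
    then have "ennreal (F ((1 / real n) *\<^sub>R S \<omega> n)) * G (T (Y0 \<omega>))
        \<le> (\<Sum>c<n. ennreal (1 / real n) * ennreal (F ((1 / real N) *\<^sub>R (\<Sum>r<N. Y c \<omega> r)))) * G (T (Y0 \<omega>))"
      by (rule mult_right_mono) simp
    then show ?thesis
      by (simp add: H_def T_Y sum_distrib_right mult.assoc)
  qed
  then have "(\<integral>\<^sup>+\<omega>. ennreal (F ((1 / real n) *\<^sub>R S \<omega> n)) * G (T (Y0 \<omega>)) \<partial>P)
      \<le> (\<integral>\<^sup>+\<omega>. (\<Sum>c<n. ennreal (1 / real n) * H (Y c \<omega>)) \<partial>P)"
    by (intro nn_integral_mono)
  also have "\<dots> = (\<Sum>c<n. ennreal (1 / real n) * (\<integral>\<^sup>+\<omega>. H (Y c \<omega>) \<partial>P))"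
    using measurable_compose[OF Y_meas H_meas]
    by (subst nn_integral_sum) (auto simp: nn_integral_cmult)
  \<comment> \<open>Exchangeability enters here: the rotated sequence has the law of the original
    one.\<close>
  also have "\<dots> = (\<Sum>c<n. ennreal (1 / real n) * (\<integral>\<^sup>+\<omega>. H (Y0 \<omega>) \<partial>P))"
    unfolding Y_def Y0_def using exchangeable_nn_integral[OF ex X s id H_meas] by simp
  also have "\<dots> = (\<integral>\<^sup>+\<omega>. H (Y0 \<omega>) \<partial>P)"
    using n by (simp add: ennreal_of_nat_eq_real_of_nat mult.assoc[symmetric] flip: ennreal_mult')
  also have "\<dots> = (\<integral>\<^sup>+\<omega>. ennreal (F ((1 / real N) *\<^sub>R S \<omega> N)) * G (T (Y0 \<omega>)) \<partial>P)"
    using N by (simp add: H_def S_eq)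
  finally show ?thesis
    by (simp add: T_S)
qed


text \<open>Ville's argument in reversed time: split the event by the last exceedance up to a
  horizon \<open>K\<close>, replace \<open>f n\<close> by \<open>f N\<close> on each piece through
  the reversed submartingale property, sum the disjoint pieces, and let \<open>K\<close>
  grow.\<close>

theorem exchangeable_maximal_inequality:
  fixes X :: "nat \<Rightarrow> 'a \<Rightarrow> 'b::{real_normed_vector, second_countable_topology}"
    and F :: "'b \<Rightarrow> real"
  assumes ex: "exchangeable P X" and X: "\<And>n. n \<ge> 1 \<Longrightarrow> X n \<in> borel_measurable P"
    and F: "convex_on UNIV F" "F \<in> borel_measurable borel" "\<And>x. 0 \<le> F x"
    and N: "1 \<le> N"
  defines "f \<equiv> \<lambda>n \<omega>. F ((1 / real n) *\<^sub>R (\<Sum>i=1..n. X i \<omega>))"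
  shows "ennreal c * emeasure P {\<omega> \<in> space P. \<exists>n\<ge>N. c < f n \<omega>} \<le> (\<integral>\<^sup>+\<omega>. ennreal (f N \<omega>) \<partial>P)"
proof -
  have f_meas [measurable]: "f n \<in> borel_measurable P" for n
    unfolding f_def
    by (intro measurable_compose[OF _ F(2)] borel_measurable_scaleR borel_measurable_sum X) auto
  define E where "E K = {\<omega> \<in> space P. \<exists>n\<in>{N..K}. c < f n \<omega>}" for K
  have E_sets: "E K \<in> sets P" for K
    unfolding E_def by measurable
  have E_le: "ennreal c * emeasure P (E K) \<le> (\<integral>\<^sup>+\<omega>. ennreal (f N \<omega>) \<partial>P)" for K
  proof -
    \<comment> \<open>\<open>D n\<close>: the last exceedance up to time \<open>K\<close> is at \<open>n\<close>, an event determined by the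
      partial sums from the \<open>n\<close>-th on.\<close>
    define D where "D n = {\<omega> \<in> space P. c < f n \<omega> \<and> (\<forall>m\<in>{n<..K}. f m \<omega> \<le> c)}" for n
    have D_sets [measurable]: "D n \<in> sets P" for n
      unfolding D_def by measurable
    have disj: "disjoint_family_on D {N..K}"
      unfolding disjoint_family_on_def
    proof (intro ballI impI)
      fix m n assume "m \<in> {N..K}" "n \<in> {N..K}" "m \<noteq> n"
      then have "m \<in> {n<..K} \<or> n \<in> {m<..K}" by auto
      then show "D m \<inter> D n = {}"
        unfolding D_def by (auto simp: not_le[symmetric])
    qed
    have E_eq: "E K = (\<Union>n\<in>{N..K}. D n)"
    proof (intro equalityI subsetI)
      fix \<omega> assume "\<omega> \<in> E K"
      define J where "J = {n \<in> {N..K}. c < f n \<omega>}"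
      have "finite J" "J \<noteq> {}"
        using \<open>\<omega> \<in> E K\<close> by (auto simp: J_def E_def)
      then have "Max J \<in> J" "m \<notin> J" if "Max J < m" for m
        using that by auto
      \<comment> \<open>\<open>lessI\<close> supplies some \<open>m\<close> beyond
        \<open>Max J\<close>, which discharges the condition attached to the first fact.\<close>
      then have J: "Max J \<in> J" and gt: "\<And>m. Max J < m \<Longrightarrow> m \<notin> J"
        using lessI by blast+
      have "f m \<omega> \<le> c" if "m \<in> {Max J<..K}" for m
        using gt[of m] that J by (force simp: J_def)
      with J show "\<omega> \<in> (\<Union>n\<in>{N..K}. D n)"
        using \<open>\<omega> \<in> E K\<close> by (auto simp: D_def E_def J_def)
    qed (auto simp: E_def D_def)
    have D_le: "ennreal c * emeasure P (D n) \<le> (\<integral>\<^sup>+\<omega>. ennreal (f N \<omega>) * indicator (D n) \<omega> \<partial>P)"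
      if n: "n \<in> {N..K}" for n
    proof -
      \<comment> \<open>The indicator of \<open>D n\<close> as a function of the partial sums.\<close>
      define G :: "(nat \<Rightarrow> 'b) \<Rightarrow> ennreal" where
        "G h = indicator {0<..} (F ((1 / real n) *\<^sub>R h n) - c)
          * (\<Prod>m\<in>{n<..K}. indicator {..0} (F ((1 / real m) *\<^sub>R h m) - c))" for h
      have "(\<lambda>h. F ((1 / real m) *\<^sub>R h m) - c) \<in> borel_measurable (\<Pi>\<^sub>M r\<in>{n..K}. borel)"
        if "m \<in> {n..K}" for m
        using that by (intro borel_measurable_diff borel_measurable_const measurable_compose[OF _ F(2)]
            borel_measurable_scaleR measurable_component_singleton) auto
      then have G: "G \<in> borel_measurable (\<Pi>\<^sub>M r\<in>{n..K}. borel)"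
        unfolding G_def using n
        by (intro borel_measurable_times_ennreal borel_measurable_prod_ennreal
            measurable_compose[OF _ borel_measurable_indicator[of _ borel]]) auto
      have prod_ind: "(\<Prod>m\<in>I. indicator {..0} (g m)) = (if \<forall>m\<in>I. g m \<le> 0 then 1 else 0 :: ennreal)"
        if "finite I" for g :: "nat \<Rightarrow> real" and I
        using that by (induction I) (auto simp: indicator_def)
      have G_eq: "G (\<lambda>m\<in>{n..K}. \<Sum>i=1..m. X i \<omega>) = indicator (D n) \<omega>" if "\<omega> \<in> space P" for \<omega>
      proof -
        have "G (\<lambda>m\<in>{n..K}. \<Sum>i=1..m. X i \<omega>)
            = indicator {0<..} (f n \<omega> - c) * (\<Prod>m\<in>{n<..K}. indicator {..0} (f m \<omega> - c))"
          unfolding G_def f_def using n by (intro arg_cong2[where f = "(*)"] prod.cong) auto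
        then show ?thesis
          using that by (auto simp: prod_ind D_def indicator_def)
      qed
      have int_eq: "(\<integral>\<^sup>+\<omega>. ennreal (f k \<omega>) * G (\<lambda>m\<in>{n..K}. \<Sum>i=1..m. X i \<omega>) \<partial>P)
          = (\<integral>\<^sup>+\<omega>. ennreal (f k \<omega>) * indicator (D n) \<omega> \<partial>P)" for k
        by (intro nn_integral_cong) (simp only: G_eq)
      have "ennreal c * emeasure P (D n) = (\<integral>\<^sup>+\<omega>. ennreal c * indicator (D n) \<omega> \<partial>P)"
        by (simp add: nn_integral_cmult_indicator)
      also have "\<dots> \<le> (\<integral>\<^sup>+\<omega>. ennreal (f n \<omega>) * indicator (D n) \<omega> \<partial>P)"
        by (intro nn_integral_mono) (auto simp: D_def indicator_def intro!: ennreal_leI)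
      \<comment> \<open>The indicator of \<open>D n\<close> is the test function \<open>G\<close>,
        so the mean of \<open>n\<close> terms may be traded for that of \<open>N\<close>
        terms.\<close>
      also have "\<dots> \<le> (\<integral>\<^sup>+\<omega>. ennreal (f N \<omega>) * indicator (D n) \<omega> \<partial>P)"
        unfolding int_eq[symmetric] unfolding f_def
        using n by (intro exchangeable_nn_integral_mean_le[OF ex X F N _ _ G]) auto
      finally show ?thesis .
    qed
    have "ennreal c * emeasure P (E K) = (\<Sum>n\<in>{N..K}. ennreal c * emeasure P (D n))"
      unfolding E_eq using disj
      by (subst sum_emeasure[symmetric]) (auto simp: sum_distrib_left)
    also have "\<dots> \<le> (\<Sum>n\<in>{N..K}. \<integral>\<^sup>+\<omega>. ennreal (f N \<omega>) * indicator (D n) \<omega> \<partial>P)"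
      by (intro sum_mono D_le)
    also have "\<dots> = (\<integral>\<^sup>+\<omega>. (\<Sum>n\<in>{N..K}. ennreal (f N \<omega>) * indicator (D n) \<omega>) \<partial>P)"
      by (rule nn_integral_sum[symmetric]) measurable
    also have "\<dots> = (\<integral>\<^sup>+\<omega>. ennreal (f N \<omega>) * indicator (\<Union>n\<in>{N..K}. D n) \<omega> \<partial>P)"
      by (simp add: indicator_UN_disjoint[OF _ disj] sum_distrib_left)
    also have "\<dots> \<le> (\<integral>\<^sup>+\<omega>. ennreal (f N \<omega>) \<partial>P)"
      by (intro nn_integral_mono) (auto simp: indicator_def)
    finally show ?thesis .
  qed
  \<comment> \<open>Continuity from below removes the horizon.\<close>
  have "incseq E"
    by (force simp: incseq_def E_def)
  moreover have "(\<Union>K. E K) = {\<omega> \<in> space P. \<exists>n\<ge>N. c < f n \<omega>}"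
    by (force simp: E_def)
  ultimately have "emeasure P {\<omega> \<in> space P. \<exists>n\<ge>N. c < f n \<omega>} = (SUP K. emeasure P (E K))"
    using SUP_emeasure_incseq[of E P] E_sets by (metis image_subsetI)
  then show ?thesis
    by (auto simp: SUP_mult_left_ennreal intro!: SUP_least E_le)
qed


text \<open>The norm of an affine map is convex, and squaring is convex and increasing on
  nonnegative numbers.\<close>

lemma convex_on_power2_norm_linear:
  fixes L :: "'b::real_vector \<Rightarrow> 'c::real_normed_vector"
  assumes "linear L"
  shows "convex_on UNIV (\<lambda>z. (norm (L (z - a)))\<^sup>2)"
proof (rule convex_onI)
  fix t :: real and x y
  assume t: "0 < t" "t < 1"
  have "L ((1 - t) *\<^sub>R x + t *\<^sub>R y - a) = L ((1 - t) *\<^sub>R (x - a) + t *\<^sub>R (y - a))"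
    by (simp add: algebra_simps)
  also have "\<dots> = (1 - t) *\<^sub>R L (x - a) + t *\<^sub>R L (y - a)"
    by (simp only: linear_add[OF assms] linear_cmul[OF assms])
  finally have "norm (L ((1 - t) *\<^sub>R x + t *\<^sub>R y - a)) \<le> (1 - t) * norm (L (x - a)) + t * norm (L (y - a))"
    using t norm_triangle_ineq[of "(1 - t) *\<^sub>R L (x - a)" "t *\<^sub>R L (y - a)"] by simp
  then have "(norm (L ((1 - t) *\<^sub>R x + t *\<^sub>R y - a)))\<^sup>2 \<le> ((1 - t) * norm (L (x - a)) + t * norm (L (y - a)))\<^sup>2"
    by (intro power_mono) auto
  also have "\<dots> \<le> (1 - t) * (norm (L (x - a)))\<^sup>2 + t * (norm (L (y - a)))\<^sup>2"
    using convex_onD[OF convex_power2, of t "norm (L (x - a))" "norm (L (y - a))"] t by simp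
  finally show "(norm (L ((1 - t) *\<^sub>R x + t *\<^sub>R y - a)))\<^sup>2
      \<le> (1 - t) * (norm (L (x - a)))\<^sup>2 + t * (norm (L (y - a)))\<^sup>2" .
qed simp

section \<open>Moments of random matrices\<close>

lemma mat_expectation_trace:
  assumes "mat_integrable P Y"
  shows integrable_trace: "integrable P (\<lambda>\<omega>. trace (Y \<omega> ** C))"
    and integral_trace: "(\<integral>\<omega>. trace (Y \<omega> ** C) \<partial>P) = trace (mat_expectation P Y ** C)"
  using assms by (simp_all add: mat_integrable_def mat_expectation_def trace_def matrix_matrix_mult_def)

text \<open>Each product of entries is dominated through
  \<open>\<bar>a * b\<bar> \<le> a\<^sup>2 + b\<^sup>2\<close>. This makes the mixed products of
  different terms of the sequence integrable.\<close>

lemma mat_integrable_mult: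
  fixes Y :: "'a \<Rightarrow> real^'n^'n" and Z :: "'a \<Rightarrow> real^'n^'n"
  assumes [measurable]: "\<And>i j. (\<lambda>\<omega>. Y \<omega> $ i $ j) \<in> borel_measurable P"
      "\<And>i j. (\<lambda>\<omega>. Z \<omega> $ i $ j) \<in> borel_measurable P"
    and Y: "\<And>i j. integrable P (\<lambda>\<omega>. (Y \<omega> $ i $ j)\<^sup>2)"
    and Z: "\<And>i j. integrable P (\<lambda>\<omega>. (Z \<omega> $ i $ j)\<^sup>2)"
  shows "mat_integrable P (\<lambda>\<omega>. Y \<omega> ** Z \<omega>)"
proof -
  have "integrable P (\<lambda>\<omega>. Y \<omega> $ i $ k * Z \<omega> $ k $ j)" for i j k
  proof (rule Bochner_Integration.integrable_bound[OF Bochner_Integration.integrable_add[OF Y[of i k] Z[of k j]]])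
    have "\<bar>a * b\<bar> \<le> a\<^sup>2 + b\<^sup>2" for a b :: real
    proof -
      have "0 \<le> (\<bar>a\<bar> - \<bar>b\<bar>)\<^sup>2" by simp
      then have "2 * \<bar>a * b\<bar> \<le> a\<^sup>2 + b\<^sup>2"
        by (simp add: power2_diff abs_mult)
      then show ?thesis by linarith
    qed
    then show "AE \<omega> in P. norm (Y \<omega> $ i $ k * Z \<omega> $ k $ j) \<le> norm ((Y \<omega> $ i $ k)\<^sup>2 + (Z \<omega> $ k $ j)\<^sup>2)"
      by simp
  qed measurable
  then show ?thesis
    by (simp add: mat_integrable_def matrix_matrix_mult_def)
qed

text \<open>By symmetry the \<open>i\<close>-th diagonal entry of the square is the sum of the
  squared entries of row \<open>i\<close>, which dominates each of them.\<close>

lemma mat_integrable_power2_imp_square_integrable: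
  assumes [measurable]: "\<And>i j. (\<lambda>\<omega>. Y \<omega> $ i $ j) \<in> borel_measurable P"
    and sym: "\<And>\<omega>. \<omega> \<in> space P \<Longrightarrow> Y \<omega> \<in> sym_mats"
    and int: "mat_integrable P (\<lambda>\<omega>. Y \<omega> ** Y \<omega>)"
  shows "integrable P (\<lambda>\<omega>. (Y \<omega> $ i $ j)\<^sup>2)"
proof (rule Bochner_Integration.integrable_bound)
  show "integrable P (\<lambda>\<omega>. (Y \<omega> ** Y \<omega>) $ i $ i)"
    using int by (simp add: mat_integrable_def)
  show "AE \<omega> in P. norm ((Y \<omega> $ i $ j)\<^sup>2) \<le> norm ((Y \<omega> ** Y \<omega>) $ i $ i)"
  proof (intro AE_I2)
    fix \<omega> assume "\<omega> \<in> space P"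
    then have "Y \<omega> $ k $ i = Y \<omega> $ i $ k" for k
      using sym[of \<omega>] by (auto simp: sym_mats_def transpose_def vec_eq_iff)
    then have "(Y \<omega> ** Y \<omega>) $ i $ i = (\<Sum>k\<in>UNIV. (Y \<omega> $ i $ k)\<^sup>2)"
      by (simp add: matrix_matrix_mult_def power2_eq_square)
    moreover have "(Y \<omega> $ i $ j)\<^sup>2 \<le> (\<Sum>k\<in>UNIV. (Y \<omega> $ i $ k)\<^sup>2)"
      by (rule member_le_sum) auto
    ultimately show "norm ((Y \<omega> $ i $ j)\<^sup>2) \<le> norm ((Y \<omega> ** Y \<omega>) $ i $ i)"
      by simp
  qed
qed measurable

section \<open>Tail bounds for the sample means\<close>

theorem theorem4p5:
  fixes P :: "'a measure"
    and X :: "nat \<Rightarrow> 'a \<Rightarrow> real^'d^'d"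
    and M V A :: "real^'d^'d"
  assumes "prob_space P"
    and "\<And>n. n \<ge> 1 \<Longrightarrow> X n \<in> borel_measurable P"
    and "\<And>n \<omega>. n \<ge> 1 \<Longrightarrow> \<omega> \<in> space P \<Longrightarrow> X n \<omega> \<in> sym_mats"
    and "exchangeable P X"
    and "mat_integrable P (X 1)"
    and "M = mat_expectation P (X 1)"
    and "mat_integrable P (\<lambda>\<omega>. (X 1 \<omega> - M) ** (X 1 \<omega> - M))"
    and "mat_expectation P (\<lambda>\<omega>. (X 1 \<omega> - M) ** (X 1 \<omega> - M)) \<preceq> V"
    and "A \<in> pd_mats"
  shows "\<P>(\<omega> in P. \<exists>n\<ge>1. \<not> mat_abs (sample_mean X n \<omega> - M) \<preceq> A)
           \<le> trace (V ** (matrix_inv A ** matrix_inv A))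
         \<and>
         ((\<forall>i\<ge>1. \<forall>j\<ge>1. i \<noteq> j \<longrightarrow>
             mat_expectation P (\<lambda>\<omega>. anticommutator (X i \<omega> - M) (X j \<omega> - M)) = 0) \<longrightarrow>
         (\<forall>N\<ge>1. \<P>(\<omega> in P. \<exists>n\<ge>N. \<not> mat_abs (sample_mean X n \<omega> - M) \<preceq> A)
           \<le> (1 / real N) * trace (V ** (matrix_inv A ** matrix_inv A))))"
proof -
  interpret prob_space P by (rule assms(1))
  have X_meas: "\<And>n. n \<ge> 1 \<Longrightarrow> X n \<in> borel_measurable P"
    and X_sym: "\<And>n \<omega>. n \<ge> 1 \<Longrightarrow> \<omega> \<in> space P \<Longrightarrow> X n \<omega> \<in> sym_mats"
    and ex: "exchangeable P X" and A: "A \<in> pd_mats"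
    using assms by auto
  define B where "B = matrix_inv A"
  define Y where "Y i \<omega> = X i \<omega> - M" for i \<omega>
  define F where "F Z = (norm ((Z - M) ** B))\<^sup>2" for Z
  \<comment> \<open>\<open>q i j\<close> is the summand in the expansion of \<open>F\<close> at a
    sample mean, written as a trace so that its integral is linear in the expectation of
    \<open>Y i ** Y j\<close>.\<close>
  define q where "q i j \<omega> = trace ((Y i \<omega> ** Y j \<omega>) ** (B ** B))" for i j \<omega>
  define a where "a = trace (mat_expectation P (\<lambda>\<omega>. Y 1 \<omega> ** Y 1 \<omega>) ** (B ** B))"
  have B: "B \<in> sym_mats"
    unfolding B_def by (rule pd_mats_inverse[OF A])
  have M: "M \<in> sym_mats"
  proof -
    have "X 1 \<omega> $ i $ j = X 1 \<omega> $ j $ i" if "\<omega> \<in> space P" for \<omega> i j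
      using X_sym[OF order_refl that] by (auto simp: sym_mats_def transpose_def vec_eq_iff)
    then show ?thesis
      by (auto simp: assms(6) sym_mats_def mat_expectation_def transpose_def vec_eq_iff
          intro!: Bochner_Integration.integral_cong)
  qed
  have Y_sym: "Y i \<omega> \<in> sym_mats" if "i \<ge> 1" "\<omega> \<in> space P" for i \<omega>
    using X_sym[OF that] M by (auto simp: Y_def sym_mats_def transpose_def vec_eq_iff)
  have entry_meas: "(\<lambda>Z :: real^'d^'d. Z $ k $ l) \<in> borel_measurable borel" for k l
    by (intro borel_measurable_continuous_onI continuous_intros)
  have X_entry: "(\<lambda>\<omega>. Y i \<omega> $ k $ l) \<in> borel_measurable P" if "i \<ge> 1" for i k l
    unfolding Y_def using measurable_compose[OF X_meas[OF that] entry_meas[of k l]] by simp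
  \<comment> \<open>Second moments are assumed finite for \<open>X 1\<close> and pass to
    \<open>X i\<close> through the common law.\<close>
  have sq: "integrable P (\<lambda>\<omega>. (Y i \<omega> $ k $ l)\<^sup>2)" if i: "i \<ge> 1" for i k l
  proof -
    have g: "(\<lambda>Z :: real^'d^'d. ((Z - M) $ k $ l)\<^sup>2) \<in> borel_measurable borel"
      by (intro borel_measurable_continuous_onI continuous_intros)
    have "integrable P (\<lambda>\<omega>. (Y 1 \<omega> $ k $ l)\<^sup>2)"
      using mat_integrable_power2_imp_square_integrable[of "Y 1" P k l, OF X_entry Y_sym] assms(7)
      by (simp add: Y_def)
    then have "integrable (distr P borel (X 1)) (\<lambda>Z. ((Z - M) $ k $ l)\<^sup>2)"
      unfolding integrable_distr_eq[OF X_meas[OF order_refl] g] by (simp add: Y_def)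
    then have "integrable (distr P borel (X i)) (\<lambda>Z. ((Z - M) $ k $ l)\<^sup>2)"
      by (simp add: exchangeable_identically_distributed[OF ex X_meas i order_refl])
    then show ?thesis
      unfolding integrable_distr_eq[OF X_meas[OF i] g] by (simp add: Y_def)
  qed
  have YY: "mat_integrable P (\<lambda>\<omega>. Y i \<omega> ** Y j \<omega>)" if "i \<ge> 1" "j \<ge> 1" for i j
    using that by (intro mat_integrable_mult X_entry sq)
  have q_int: "integrable P (q i j)" if "i \<ge> 1" "j \<ge> 1" for i j
    unfolding q_def by (intro integrable_trace YY that)
  have q_diag: "(\<integral>\<omega>. q i i \<omega> \<partial>P) = a" if i: "i \<ge> 1" for i
  proof -
    have g: "(\<lambda>Z. trace (((Z - M) ** (Z - M)) ** (B ** B))) \<in> borel_measurable borel"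
      unfolding trace_def matrix_matrix_mult_def
      by (intro borel_measurable_continuous_onI) (simp, intro continuous_intros)
    have "(\<integral>\<omega>. q j j \<omega> \<partial>P) = (\<integral>Z. trace (((Z - M) ** (Z - M)) ** (B ** B)) \<partial>distr P borel (X j))"
      if "j \<ge> 1" for j
      unfolding integral_distr[OF X_meas[OF that] g] by (simp add: q_def Y_def)
    then have "(\<integral>\<omega>. q i i \<omega> \<partial>P) = (\<integral>\<omega>. q 1 1 \<omega> \<partial>P)"
      using exchangeable_identically_distributed[OF ex X_meas i order_refl] i by simp
    also have "\<dots> = a"
      unfolding q_def a_def by (intro integral_trace YY) auto
    finally show ?thesis .
  qed
  have lin: "linear (\<lambda>Z :: real^'d^'d. Z ** B)"
    by (intro linearI) (simp_all add: matrix_matrix_mult_def vec_eq_iff sum.distrib sum_distrib_left algebra_simps)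
  have F: "convex_on UNIV F" "F \<in> borel_measurable borel" "\<And>Z. 0 \<le> F Z"
  proof -
    show "convex_on UNIV F"
      unfolding F_def by (rule convex_on_power2_norm_linear[OF lin])
    show "F \<in> borel_measurable borel"
      unfolding F_def
      by (intro borel_measurable_continuous_onI continuous_intros
          linear_continuous_on_compose[OF _ lin])
  qed (simp add: F_def)
  have q_inner: "q i j \<omega> = (Y i \<omega> ** B) \<bullet> (Y j \<omega> ** B)" if "i \<ge> 1" "\<omega> \<in> space P" for i j \<omega>
    unfolding q_def by (rule inner_sym_mult_eq_trace[OF Y_sym[OF that] B, symmetric])
  have F_mean: "F (sample_mean X n \<omega>) = (1 / (real n)\<^sup>2) * (\<Sum>i=1..n. \<Sum>j=1..n. q i j \<omega>)"
    if n: "n \<ge> 1" and \<omega>: "\<omega> \<in> space P" for n \<omega>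
  proof -
    have "sample_mean X n \<omega> - M = (1 / real n) *\<^sub>R (\<Sum>i=1..n. Y i \<omega>)"
      using n by (simp add: sample_mean_def Y_def sum_subtractf scaleR_diff_right sum_constant_scaleR del: sum_constant)
    then have "(sample_mean X n \<omega> - M) ** B = (1 / real n) *\<^sub>R (\<Sum>i=1..n. Y i \<omega> ** B)"
      by (simp add: linear_cmul[OF lin] linear_sum[OF lin])
    then have "F (sample_mean X n \<omega>)
        = (1 / (real n)\<^sup>2) * ((\<Sum>i=1..n. Y i \<omega> ** B) \<bullet> (\<Sum>j=1..n. Y j \<omega> ** B))"
      by (simp add: F_def power_mult_distrib power_divide power2_norm_eq_inner)
    also have "(\<Sum>i=1..n. Y i \<omega> ** B) \<bullet> (\<Sum>j=1..n. Y j \<omega> ** B) = (\<Sum>i=1..n. \<Sum>j=1..n. q i j \<omega>)"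
      unfolding inner_sum_left inner_sum_right using \<omega> by (intro sum.cong refl) (simp add: q_inner inner_commute)
    finally show ?thesis .
  qed
  have F_meas [measurable]: "(\<lambda>\<omega>. F (sample_mean X n \<omega>)) \<in> borel_measurable P" for n
    unfolding sample_mean_def
    by (intro measurable_compose[OF _ F(2)] borel_measurable_scaleR borel_measurable_sum X_meas) auto
  \<comment> \<open>Both claims come from this bound: \<open>N = 1\<close> leaves one diagonal term,
    and for general \<open>N\<close> the off-diagonal terms cancel under the anticommutator
    hypothesis.\<close>
  have bound: "\<P>(\<omega> in P. \<exists>n\<ge>N. \<not> mat_abs (sample_mean X n \<omega> - M) \<preceq> A)
      \<le> (1 / (real N)\<^sup>2) * (\<Sum>i=1..N. \<Sum>j=1..N. \<integral>\<omega>. q i j \<omega> \<partial>P)" if N: "N \<ge> 1" for N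
  proof -
    let ?E = "{\<omega> \<in> space P. \<exists>n\<ge>N. 1 < F (sample_mean X n \<omega>)}"
    let ?g = "\<lambda>\<omega>. (1 / (real N)\<^sup>2) * (\<Sum>i=1..N. \<Sum>j=1..N. q i j \<omega>)"
    \<comment> \<open>Contrapositive of \<open>mat_abs_loewner_leI\<close>; negating a norm of at
      most 1 gives the strict threshold 1 for \<open>F\<close>.\<close>
    have sub: "{\<omega> \<in> space P. \<exists>n\<ge>N. \<not> mat_abs (sample_mean X n \<omega> - M) \<preceq> A} \<subseteq> ?E"
    proof clarify
      fix \<omega> n assume \<omega>: "\<omega> \<in> space P" "N \<le> n" "\<not> mat_abs (sample_mean X n \<omega> - M) \<preceq> A"
      have "X i \<omega> $ k $ l = X i \<omega> $ l $ k" if "i \<ge> 1" for i k l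
        using X_sym[OF that \<omega>(1)] by (auto simp: sym_mats_def transpose_def vec_eq_iff)
      then have "sample_mean X n \<omega> - M \<in> sym_mats"
        using M by (auto simp: sample_mean_def sym_mats_def transpose_def vec_eq_iff intro!: sum.cong)
      then have "1 < norm ((sample_mean X n \<omega> - M) ** B)"
        using mat_abs_loewner_leI[OF _ A] \<omega>(3) unfolding B_def by force
      then show "\<exists>n\<ge>N. 1 < F (sample_mean X n \<omega>)"
        using \<omega>(2) unfolding F_def by (metis one_less_power pos2)
    qed
    have g_int: "integrable P ?g"
      by (intro integrable_mult_right Bochner_Integration.integrable_sum q_int) auto
    have g_nonneg: "0 \<le> ?g \<omega>" if "\<omega> \<in> space P" for \<omega>
      using F_mean[OF N that] F(3) by metis
    have "emeasure P ?E \<le> (\<integral>\<^sup>+\<omega>. ennreal (F (sample_mean X N \<omega>)) \<partial>P)"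
      using exchangeable_maximal_inequality[OF ex X_meas F N, of 1] by (simp add: sample_mean_def)
    also have "\<dots> = (\<integral>\<^sup>+\<omega>. ennreal (?g \<omega>) \<partial>P)"
      using F_mean[OF N] by (intro nn_integral_cong) simp
    also have "\<dots> = ennreal (\<integral>\<omega>. ?g \<omega> \<partial>P)"
      using g_nonneg by (intro nn_integral_eq_integral g_int AE_I2)
    finally have "measure P ?E \<le> (\<integral>\<omega>. ?g \<omega> \<partial>P)"
      unfolding measure_def using g_nonneg by (intro enn2real_leI integral_nonneg_AE AE_I2)
    also have "(\<integral>\<omega>. ?g \<omega> \<partial>P) = (1 / (real N)\<^sup>2) * (\<Sum>i=1..N. \<Sum>j=1..N. \<integral>\<omega>. q i j \<omega> \<partial>P)"
    proof -
      have "(\<integral>\<omega>. (\<Sum>i=1..N. \<Sum>j=1..N. q i j \<omega>) \<partial>P) = (\<Sum>i=1..N. \<integral>\<omega>. (\<Sum>j=1..N. q i j \<omega>) \<partial>P)"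
        by (intro Bochner_Integration.integral_sum Bochner_Integration.integrable_sum q_int) auto
      also have "\<dots> = (\<Sum>i=1..N. \<Sum>j=1..N. \<integral>\<omega>. q i j \<omega> \<partial>P)"
        by (intro sum.cong refl Bochner_Integration.integral_sum q_int) auto
      finally show ?thesis
        by (simp only: Bochner_Integration.integral_mult_right_zero)
    qed
    finally have "measure P ?E \<le> \<dots>" .
    \<comment> \<open>The event of the claim enters as a subset of \<open>?E\<close>, so
      monotonicity of the measure asks for measurability of \<open>?E\<close> alone.\<close>
    moreover have "?E \<in> sets P"
      by measurable
    ultimately show ?thesis
      using finite_measure_mono[OF sub] by linarith
  qed
  have a_le: "a \<le> trace (V ** (B ** B))"
    unfolding a_def Y_def by (rule trace_mult_mono[OF assms(8) B])
  show ?thesis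
    unfolding B_def[symmetric]
  proof (intro conjI impI allI)
    show "\<P>(\<omega> in P. \<exists>n\<ge>1. \<not> mat_abs (sample_mean X n \<omega> - M) \<preceq> A) \<le> trace (V ** (B ** B))"
      using bound[of 1] q_diag[of 1] a_le by simp
  next
    fix N :: nat
    assume anti: "\<forall>i\<ge>1. \<forall>j\<ge>1. i \<noteq> j \<longrightarrow>
             mat_expectation P (\<lambda>\<omega>. anticommutator (X i \<omega> - M) (X j \<omega> - M)) = 0"
      and N: "1 \<le> N"
    define e where "e i j = (\<integral>\<omega>. q i j \<omega> \<partial>P)" for i j
    \<comment> \<open>The anticommutator controls the sum \<open>e i j + e j i\<close>, not each
      summand. The double sum is therefore added to its transpose below, which accounts for the
      factor 2.\<close>
    have e: "e i j + e j i = (if i = j then 2 * a else 0)" if ij: "i \<ge> 1" "j \<ge> 1" for i j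
    proof (cases "i = j")
      case False
      have "mat_integrable P (\<lambda>\<omega>. anticommutator (Y i \<omega>) (Y j \<omega>))"
        using YY[OF ij] YY[OF ij(2,1)] by (simp add: mat_integrable_def anticommutator_def)
      then have "(\<integral>\<omega>. trace (anticommutator (Y i \<omega>) (Y j \<omega>) ** (B ** B)) \<partial>P) = trace (0 ** (B ** B))"
        using anti ij False by (subst integral_trace) (auto simp: Y_def)
      then have "(\<integral>\<omega>. q i j \<omega> + q j i \<omega> \<partial>P) = 0"
        by (simp add: q_def anticommutator_def trace_def matrix_matrix_mult_def sum.distrib algebra_simps)
      then show ?thesis
        using False q_int[OF ij] q_int[OF ij(2,1)] by (simp add: e_def)
    qed (use q_diag[OF ij(2)] in \<open>simp add: e_def\<close>)
    have swap: "(\<Sum>i=1..N. \<Sum>j=1..N. e j i) = (\<Sum>i=1..N. \<Sum>j=1..N. e i j)"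
      by (rule sum.swap)
    have "2 * (\<Sum>i=1..N. \<Sum>j=1..N. e i j) = (\<Sum>i=1..N. \<Sum>j=1..N. e i j + e j i)"
      unfolding sum.distrib swap by simp
    also have "\<dots> = (\<Sum>i=1..N. \<Sum>j=1..N. if i = j then 2 * a else 0)"
      by (intro sum.cong refl e) auto
    also have "\<dots> = 2 * (real N * a)"
      by simp
    finally have "(1 / (real N)\<^sup>2) * (\<Sum>i=1..N. \<Sum>j=1..N. e i j) = (1 / real N) * a"
      using N by (simp add: power2_eq_square)
    also have "\<dots> \<le> (1 / real N) * trace (V ** (B ** B))"
      using a_le by (intro mult_left_mono) auto
    finally show "\<P>(\<omega> in P. \<exists>n\<ge>N. \<not> mat_abs (sample_mean X n \<omega> - M) \<preceq> A)
        \<le> (1 / real N) * trace (V ** (B ** B))"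
      using bound[OF N] unfolding e_def by linarith
  qed
qed

end
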